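(* Let $n\ge 2$, let $S^n$ denote the unit sphere $\{x\in\mathbb{R}^n : |x|=1\}$ of $\mathbb{R}^n$, and let $x_0\in\mathbb{R}^n$. For any positive integer $m$, the space $\mathcal{P}(x_0,m)$ (restricted to $S^n$) is dense in $\mathcal{C}(x_0,S^n)$ with the sup norm if and only if $|x_0|\ge 1$. (When $x_0$ is not on the sphere, $\mathcal{C}(x_0,S^n)$ is the same as $\mathcal{C}(S^n)$.)
   Context: Following the paper's notation, $S^n$ is the unit sphere in $\mathbb{R}^n$ (not in $\mathbb{R}^{n+1}$). Functions are real-valued. $\mathcal{P}(x_0,m)$ denotes the space of all harmonic polynomials on $\mathbb{R}^n$ which vanish at $x_0$ together with all their partial derivatives of order less than or equal to $m$. $\mathcal{C}(S^n)$ denotes the space of all continuous functions on $S^n$. $\mathcal{C}(x_0,S^n)$ denotes the space of all continuous functions on $S^n$ that vanish at $x_0$ if $x_0\in S^n$, and the space $\mathcal{C}(S^n)$ of all continuous functions on $S^n$ if $x_0\notin S^n$. *)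

theory Defs
  imports "HOL-Analysis.Analysis"
begin

definition partial_deriv :: "'n \<Rightarrow> (real ^ 'n \<Rightarrow> real) \<Rightarrow> real ^ 'n \<Rightarrow> real" where
  "partial_deriv i f x = deriv (\<lambda>t. f (x + t *\<^sub>R axis i 1)) 0"

text \<open>A list of coordinate indices of length \<open>k\<close> encodes a partial derivative of order \<open>k\<close>;
  the empty list gives the function itself.\<close>
definition iterated_partial :: "'n list \<Rightarrow> (real ^ 'n \<Rightarrow> real) \<Rightarrow> real ^ 'n \<Rightarrow> real" where
  "iterated_partial is f = foldr partial_deriv is f"

definition laplacian :: "(real ^ 'n \<Rightarrow> real) \<Rightarrow> real ^ 'n \<Rightarrow> real" where
  "laplacian f x = (\<Sum>i\<in>UNIV. partial_deriv i (partial_deriv i f) x)"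

text \<open>Polynomial functions are smooth, so a vanishing Laplacian is the only further condition.\<close>
definition harmonic_polynomial :: "(real ^ 'n \<Rightarrow> real) \<Rightarrow> bool" where
  "harmonic_polynomial p \<longleftrightarrow> real_polynomial_function p \<and> (\<forall>x. laplacian p x = 0)"

definition harmonic_polys_vanishing :: "real ^ 'n \<Rightarrow> nat \<Rightarrow> (real ^ 'n \<Rightarrow> real) set" where
  "harmonic_polys_vanishing x0 m =
     {p. harmonic_polynomial p \<and> (\<forall>is. length is \<le> m \<longrightarrow> iterated_partial is p x0 = 0)}"

text \<open>The sup metric on the continuous real functions on the unit sphere. Its points are
  functions that are \<open>undefined\<close> off the sphere; hence \<open>restrict\<close> below. The boundedness
  built into \<open>cfunspace\<close> is automatic, the sphere being compact.\<close>
definition sphere_cfunspace :: "(real ^ 'n \<Rightarrow> real) metric" where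
  "sphere_cfunspace = cfunspace (top_of_set (sphere 0 1)) euclidean_metric"

lemma restrict_in_sphere_cfunspace_iff:
  "restrict f (sphere 0 1) \<in> mspace (sphere_cfunspace :: (real ^ 'n \<Rightarrow> real) metric)
     \<longleftrightarrow> continuous_on (sphere 0 1) f"
proof -
  have eq: "continuous_on (sphere 0 1) (restrict f (sphere 0 1)) \<longleftrightarrow> continuous_on (sphere 0 1) f"
    by (rule continuous_on_cong) auto
  have top: "mtopology_of euclidean_metric = (euclidean :: real topology)"
    by (simp add: mtopology_of_def)
  have bdd: "bounded (f ` sphere 0 1)" if "continuous_on (sphere 0 1) f"
    using that by (intro compact_imp_bounded compact_continuous_image) auto
  show ?thesis
    using eq bdd by (auto simp: sphere_cfunspace_def top simp del: restrict_apply)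
qed

definition sphere_cfuns_vanishing :: "real ^ 'n \<Rightarrow> (real ^ 'n \<Rightarrow> real) set" where
  "sphere_cfuns_vanishing x0 =
     {f \<in> mspace sphere_cfunspace. x0 \<in> sphere 0 1 \<longrightarrow> f x0 = 0}"

definition dense_in :: "'a topology \<Rightarrow> 'a set \<Rightarrow> 'a set \<Rightarrow> bool" where
  "dense_in T A B \<longleftrightarrow> A \<subseteq> B \<and> B \<subseteq> T closure_of A"

end

theory Submission
  imports Defs "HOL-Computational_Algebra.Polynomial"
begin

text \<open>
  If \<open>norm x0 < 1\<close>, the minimum principle on the ball prevents harmonic polynomials vanishing at
  \<open>x0\<close> from approaching the constant \<open>1\<close>.

  If \<open>R = norm x0 \<ge> 1\<close>, put \<open>e = x0 / R\<close>, and for each unit vector \<open>v\<close> orthogonal to \<open>e\<close> let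
  \<open>z\<^sub>v(x) = e \<bullet> x + \<i> (v \<bullet> x)\<close>. This isotropic linear form maps the sphere into the closed unit
  disc and \<open>x0\<close> to \<open>R\<close>, and the real part of \<open>h(z\<^sub>v)\<close> is harmonic for every complex polynomial \<open>h\<close>,
  with the order of vanishing of \<open>h\<close> at \<open>R\<close> passing to \<open>x0\<close>. On the disc, \<open>z ^ j\<close>
  (if \<open>R > 1\<close>) or \<open>z ^ j - 1\<close> (if \<open>R = 1\<close>) is a uniform limit of polynomials vanishing to any
  prescribed order at \<open>R\<close>. It remains to see that the powers of the \<open>z\<^sub>v\<close> span all polynomial
  functions on the sphere. Rotating \<open>v\<close> towards a unit vector \<open>w\<close> orthogonal to \<open>e\<close> and \<open>v\<close>, with
  the rational parametrization of the circle, puts every coefficient in \<open>s\<close> of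
  \<open>(z\<^sub>v + 2 \<i> (w \<bullet> x) s + cnj z\<^sub>v s\<^sup>2) ^ k\<close> into the span; the coefficients of \<open>s\<close> and \<open>s\<^sup>2\<close>, the
  latter summed over an orthonormal basis of such \<open>w\<close>, show that the span is closed under
  multiplication by linear functions.
\<close>

subsection \<open>Powers of isotropic linear forms on the sphere\<close>

text \<open>Applied below with \<open>a\<close>, \<open>c\<close> a conjugate pair and
  \<open>b\<close> a multiple of \<open>w \<bullet> x\<close>. Doubling the coefficient at 2 avoids
  dividing by 2 in a general ring.\<close>

lemma coeff_quadratic_power:
  fixes a b c :: "'a::comm_ring_1"
  shows "coeff ([:a, b, c:] ^ k) 0 = a ^ k"
    and "coeff ([:a, b, c:] ^ Suc k) 1 = of_nat (Suc k) * a ^ k * b"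
    and "2 * coeff ([:a, b, c:] ^ Suc (Suc k)) 2
           = 2 * of_nat (Suc (Suc k)) * a ^ Suc k * c + of_nat (Suc k * Suc (Suc k)) * a ^ k * b\<^sup>2"
proof -
  show c0: "coeff ([:a, b, c:] ^ k) 0 = a ^ k" for k
    by (simp add: coeff_0_power)
  show c1: "coeff ([:a, b, c:] ^ Suc k) 1 = of_nat (Suc k) * a ^ k * b" for k
    by (induction k) (simp_all add: c0 algebra_simps)
  show "2 * coeff ([:a, b, c:] ^ Suc (Suc k)) 2
           = 2 * of_nat (Suc (Suc k)) * a ^ Suc k * c + of_nat (Suc k * Suc (Suc k)) * a ^ k * b\<^sup>2"
  proof (induction k)
    case 0
    show ?case by (simp add: numeral_2_eq_2 power2_eq_square algebra_simps)
  next
    case (Suc k)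
    let ?q = "[:a, b, c:]"
    have "coeff (?q ^ Suc (Suc (Suc k))) 2
        = a * coeff (?q ^ Suc (Suc k)) 2 + b * coeff (?q ^ Suc (Suc k)) 1 + c * coeff (?q ^ Suc (Suc k)) 0"
      by (subst power_Suc) (simp add: coeff_mult numeral_2_eq_2 del: power_Suc mult_pCons_left)
    then have "2 * coeff (?q ^ Suc (Suc (Suc k))) 2
        = a * (2 * coeff (?q ^ Suc (Suc k)) 2) + 2 * b * coeff (?q ^ Suc (Suc k)) 1
          + 2 * c * coeff (?q ^ Suc (Suc k)) 0"
      by (simp only:) (simp add: algebra_simps del: power_Suc mult_pCons_left)
    also have "\<dots> = a * (2 * of_nat (Suc (Suc k)) * a ^ Suc k * c
            + of_nat (Suc k * Suc (Suc k)) * a ^ k * b\<^sup>2)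
          + 2 * b * (of_nat (Suc (Suc k)) * a ^ Suc k * b) + 2 * c * a ^ Suc (Suc k)"
      by (simp only: Suc.IH c0 c1)
    also have "\<dots> = 2 * of_nat (Suc (Suc (Suc k))) * a ^ Suc (Suc k) * c
        + of_nat (Suc (Suc k) * Suc (Suc (Suc k))) * a ^ Suc k * b\<^sup>2"
      by (simp add: power2_eq_square algebra_simps)
    finally show ?case .
  qed
qed

text \<open>For orthonormal \<open>e\<close>, \<open>v\<close> this is pairing with the isotropic
  vector e + i v. Orthonormality is imposed only later, in \<open>iso_span.power\<close> and
  \<open>vanishing_pairs\<close>.\<close>

definition iso_form :: "'a::euclidean_space \<Rightarrow> 'a \<Rightarrow> 'a \<Rightarrow> complex" where
  "iso_form e v x = Complex (e \<bullet> x) (v \<bullet> x)"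

text \<open>Rule \<open>cong\<close> makes membership depend only on values on the unit sphere, so
  that \<open>x \<bullet> x = 1\<close> may be used. Closure under products is not built in; it has
  to be derived.\<close>

inductive_set iso_span :: "'a::euclidean_space \<Rightarrow> ('a \<Rightarrow> complex) set" for e where
  power: "norm v = 1 \<Longrightarrow> v \<bullet> e = 0 \<Longrightarrow> (\<lambda>x. iso_form e v x ^ k) \<in> iso_span e"
| add: "F \<in> iso_span e \<Longrightarrow> G \<in> iso_span e \<Longrightarrow> (\<lambda>x. F x + G x) \<in> iso_span e"
| scale: "F \<in> iso_span e \<Longrightarrow> (\<lambda>x. c * F x) \<in> iso_span e"
| cong: "F \<in> iso_span e \<Longrightarrow> (\<And>x. x \<in> sphere 0 1 \<Longrightarrow> F x = G x) \<Longrightarrow> G \<in> iso_span e"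

lemma iso_span_diff: "F \<in> iso_span e \<Longrightarrow> G \<in> iso_span e \<Longrightarrow> (\<lambda>x. F x - G x) \<in> iso_span e"
proof -
  assume "F \<in> iso_span e" "G \<in> iso_span e"
  then have "(\<lambda>x. F x + (- 1) * G x) \<in> iso_span e"
    by (intro iso_span.add iso_span.scale)
  then show ?thesis by simp
qed

lemma iso_span_scale_cancel:
  assumes "(\<lambda>x. c * F x) \<in> iso_span e" "c \<noteq> 0"
  shows "F \<in> iso_span e"
  using iso_span.scale[OF assms(1), of "inverse c"] assms(2) by (simp add: mult.assoc[symmetric])

text \<open>With P(s) the given sum of degree d + 1, the combination P(2s) - 2^(d+1) P(s) kills the
  top coefficient and multiplies the j-th one by 2^j - 2^(d+1), which is nonzero for j at most d.
  Induction yields the lower coefficients, and P(1) then yields the top one.\<close>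

lemma iso_span_coeffs:
  assumes "\<And>s::real. (\<lambda>x. \<Sum>j\<le>d. of_real s ^ j * c j x) \<in> iso_span e" "j \<le> d"
  shows "c j \<in> iso_span e"
  using assms
proof (induction d arbitrary: c j)
  case 0
  then show ?case by simp
next
  case (Suc d)
  have low: "c j \<in> iso_span e" if "j \<le> d" for j
  proof -
    have "(\<lambda>x. \<Sum>j\<le>d. of_real s ^ j * ((2 ^ j - 2 ^ Suc d) * c j x)) \<in> iso_span e" for s
    proof (rule iso_span.cong)
      show "(\<lambda>x. (\<Sum>j\<le>Suc d. of_real (2 * s) ^ j * c j x)
              - 2 ^ Suc d * (\<Sum>j\<le>Suc d. of_real s ^ j * c j x)) \<in> iso_span e"
        by (intro iso_span_diff iso_span.scale Suc.prems)
    qed (simp add: sum_distrib_left sum_subtractf[symmetric] power_mult_distrib algebra_simps)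
    from Suc.IH[OF this that] have "(\<lambda>x. (2 ^ j - 2 ^ Suc d) * c j x) \<in> iso_span e" .
    moreover have "(2 ^ j - 2 ^ Suc d :: complex) \<noteq> 0"
    proof -
      have "(2::real) ^ j < 2 ^ Suc d" using that by (intro power_strict_increasing) auto
      then have "(2 ^ j :: real) \<noteq> 2 ^ Suc d" by simp
      then have "complex_of_real (2 ^ j) \<noteq> complex_of_real (2 ^ Suc d)"
        by (simp only: of_real_eq_iff not_False_eq_True)
      then show ?thesis by simp
    qed
    ultimately show ?thesis by (rule iso_span_scale_cancel)
  qed
  have sums: "(\<lambda>x. \<Sum>j\<in>J. c j x) \<in> iso_span e" if "J \<subseteq> {..d}" "finite J" for J
    using that(2,1)
  proof (induction J rule: finite_induct)
    case empty
    have "(\<lambda>x. 0 * c 0 x) \<in> iso_span e" by (intro iso_span.scale low) simp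
    then show ?case by simp
  next
    case (insert j J)
    then show ?case using iso_span.add[OF low[of j]] by simp
  qed
  have top: "c (Suc d) \<in> iso_span e"
  proof -
    have "(\<lambda>x. (\<Sum>j\<le>Suc d. of_real 1 ^ j * c j x) - (\<Sum>j\<in>{..d}. c j x)) \<in> iso_span e"
      by (intro iso_span_diff Suc.prems sums) auto
    then show ?thesis by simp
  qed
  show ?case using low top Suc.prems(2) by (cases "j = Suc d") auto
qed

text \<open>For every real s the vector u = ((1 - s^2) v + 2 s w) / (1 + s^2) is a unit vector
  orthogonal to \<open>e\<close>, and (1 + s^2) z_u is the displayed quadratic evaluated at s. Its
  k-th power is therefore in the span for all s, hence so are its coefficients.\<close>

lemma iso_span_quadratic:
  assumes e: "norm e = 1" and v: "norm v = 1" "v \<bullet> e = 0" and w: "norm w = 1" "w \<bullet> e = 0" "w \<bullet> v = 0"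
    and j: "j \<le> 2 * k"
  shows "(\<lambda>x. coeff ([:iso_form e v x, 2 * \<i> * of_real (w \<bullet> x), cnj (iso_form e v x):] ^ k) j)
           \<in> iso_span e" (is "(\<lambda>x. coeff (?q x ^ k) j) \<in> _")
proof -
  have "(\<lambda>x. \<Sum>j\<le>2 * k. of_real s ^ j * coeff (?q x ^ k) j) \<in> iso_span e" for s
  proof -
    define D where "D = 1 + s\<^sup>2"
    have D: "D > 0" unfolding D_def by (simp add: add_pos_nonneg)
    define u where "u = ((1 - s\<^sup>2) / D) *\<^sub>R v + (2 * s / D) *\<^sub>R w"
    have vw: "v \<bullet> v = 1" "w \<bullet> w = 1" "v \<bullet> w = 0"
      using v w by (auto simp: norm_eq_1 inner_commute)
    have "u \<bullet> u = ((1 - s\<^sup>2) / D)\<^sup>2 + (2 * s / D)\<^sup>2"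
      unfolding u_def using vw w by (simp add: inner_add_left inner_add_right power2_eq_square)
    also have "\<dots> = ((1 - s\<^sup>2)\<^sup>2 + (2 * s)\<^sup>2) / D\<^sup>2"
      by (simp add: power_divide add_divide_distrib)
    also have "(1 - s\<^sup>2)\<^sup>2 + (2 * s)\<^sup>2 = D\<^sup>2"
      unfolding D_def by (simp add: power2_eq_square algebra_simps)
    finally have "norm u = 1" using D by (simp add: norm_eq_1)
    moreover have "u \<bullet> e = 0" unfolding u_def using v w by (simp add: inner_add_left)
    ultimately have "(\<lambda>x. of_real D ^ k * iso_form e u x ^ k) \<in> iso_span e"
      by (intro iso_span.scale iso_span.power)
    then show ?thesis
    proof (rule iso_span.cong)
      fix x
      have "D * (u \<bullet> x) = D * (((1 - s\<^sup>2) / D) * (v \<bullet> x)) + D * ((2 * s / D) * (w \<bullet> x))"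
        unfolding u_def by (simp add: inner_add_left ring_distribs)
      also have "\<dots> = (1 - s\<^sup>2) * (v \<bullet> x) + 2 * s * (w \<bullet> x)"
        using D by simp
      finally have "of_real D * iso_form e u x = poly (?q x) (of_real s)"
        unfolding iso_form_def
        by (simp add: complex_eq_iff D_def algebra_simps power2_eq_square)
      \<comment> \<open>Only an upper bound holds, because the leading coefficient
        \<open>cnj (iso_form e v x)\<close> may vanish; the power is padded with zero coefficients
        up to \<open>2 * k\<close>.\<close>
      moreover have "degree (?q x) \<le> 2"
        by (rule degree_le) (auto simp: coeff_pCons split: nat.split)
      then have "degree (?q x ^ k) \<le> 2 * k"
        by (rule order_trans[OF degree_power_le mult_right_mono]) simp
      then have "poly (?q x ^ k) (of_real s) = (\<Sum>j\<le>2 * k. coeff (?q x ^ k) j * of_real s ^ j)"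
        unfolding poly_altdef
        by (intro sum.mono_neutral_left) (auto simp: coeff_eq_0)
      ultimately show "of_real D ^ k * iso_form e u x ^ k = (\<Sum>j\<le>2 * k. of_real s ^ j * coeff (?q x ^ k) j)"
        by (simp add: power_mult_distrib[symmetric] poly_power mult.commute del: poly_pCons)
    qed
  qed
  from iso_span_coeffs[OF this j] show ?thesis .
qed


text \<open>The vector \<open>v\<close> is a real hypothesis: if no unit vector is orthogonal to
  \<open>e\<close>, no rule ever applies and \<open>iso_span e\<close> is empty.\<close>

lemma iso_span_zero:
  assumes "norm v = 1" "v \<bullet> e = 0"
  shows "(\<lambda>x. 0) \<in> iso_span e"
  using iso_span.scale[OF iso_span.power[OF assms, of 0], of 0] by simp

lemma iso_span_sum:
  assumes "norm v = 1" "v \<bullet> e = 0" "\<And>i. i \<in> I \<Longrightarrow> F i \<in> iso_span e"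
  shows "(\<lambda>x. \<Sum>i\<in>I. F i x) \<in> iso_span e"
proof (cases "finite I")
  case True
  then show ?thesis using assms(3)
  proof (induction I rule: finite_induct)
    case empty
    show ?case using iso_span_zero[OF assms(1,2)] by simp
  next
    case (insert i I)
    then show ?case using iso_span.add[of "F i" e] by simp
  qed
qed (use iso_span_zero[OF assms(1,2)] in simp)

text \<open>\<open>W\<close> is an orthonormal basis of the orthogonal complement of
  \<open>e\<close> and \<open>v\<close>, empty in dimension 2, and the identity is Parseval's. It
  serves both to compute the sum of squares over \<open>W\<close> on the sphere and to expand linear
  functions.\<close>

lemma orthonormal_pair_extension:
  fixes e v :: "'a::euclidean_space"
  assumes e: "norm e = 1" and v: "norm v = 1" "v \<bullet> e = 0"
  shows "\<exists>W. finite W \<and> (\<forall>w\<in>W. norm w = 1 \<and> w \<bullet> e = 0 \<and> w \<bullet> v = 0) \<and>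
           (\<forall>x y. x \<bullet> y = (e \<bullet> x) * (e \<bullet> y) + (v \<bullet> x) * (v \<bullet> y) + (\<Sum>w\<in>W. (w \<bullet> x) * (w \<bullet> y)))"
proof -
  have ne: "e \<noteq> v" "e \<noteq> 0" "v \<noteq> 0" using e v by (auto simp: norm_eq_1)
  define T where "T = {x. \<forall>y\<in>{e, v}. orthogonal y x}"
  have sub: "subspace T" unfolding T_def by (rule subspace_orthogonal_to_vectors)
  obtain W where W: "W \<subseteq> T" "pairwise orthogonal W" "\<And>x. x \<in> W \<Longrightarrow> norm x = 1"
      "independent W" "span W = T"
    using orthonormal_basis_subspace[OF sub] by metis
  have fin: "finite W" using W(4) by (rule finiteI_independent)
  have orth: "w \<bullet> e = 0 \<and> w \<bullet> v = 0" if "w \<in> W" for w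
    using that W(1) by (auto simp: T_def orthogonal_def inner_commute)
  have notin: "e \<notin> W" "v \<notin> W"
    using orth[of e] orth[of v] ne by auto
  have pw: "pairwise orthogonal (insert e (insert v W))"
    using W(2) orth v by (auto simp: pairwise_insert orthogonal_def inner_commute)
  have spn: "x \<in> span (insert e (insert v W))" for x
  proof -
    define y where "y = x - (e \<bullet> x) *\<^sub>R e - (v \<bullet> x) *\<^sub>R v"
    have "y \<in> T"
      using e v by (simp add: T_def orthogonal_def y_def inner_diff_right norm_eq_1 inner_commute)
    then have "y \<in> span (insert e (insert v W))"
      using W(5) span_mono[of W "insert e (insert v W)"] by blast
    then have "y + (e \<bullet> x) *\<^sub>R e + (v \<bullet> x) *\<^sub>R v \<in> span (insert e (insert v W))"
      by (intro span_add span_scale) (auto intro: span_base)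
    then show ?thesis by (simp add: y_def)
  qed
  have ip: "x \<bullet> y = (e \<bullet> x) * (e \<bullet> y) + (v \<bullet> x) * (v \<bullet> y) + (\<Sum>w\<in>W. (w \<bullet> x) * (w \<bullet> y))" for x y
  proof -
    have "(\<Sum>i\<in>insert e (insert v W). (x \<bullet> i) *\<^sub>R i) = x"
      by (rule orthonormal_basis_expand[OF pw _ spn]) (use W(3) e v fin in auto)
    then have "x \<bullet> y = (\<Sum>i\<in>insert e (insert v W). (x \<bullet> i) *\<^sub>R i) \<bullet> y" by simp
    also have "\<dots> = (\<Sum>i\<in>insert e (insert v W). (x \<bullet> i) * (i \<bullet> y))"
      by (simp add: inner_sum_left)
    finally show ?thesis
      using fin notin ne by (simp add: inner_commute)
  qed
  show ?thesis
    by (rule exI[of _ W], intro conjI ballI allI) (auto simp: fin orth W(3) intro: ip)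
qed

text \<open>Bessel's inequality: drop the nonnegative sum over \<open>W\<close>.\<close>

lemma norm_iso_form_le:
  assumes "norm e = 1" "norm v = 1" "v \<bullet> e = 0" "norm x = 1"
  shows "norm (iso_form e v x) \<le> 1"
proof -
  obtain W where W: "finite W" 
    "\<And>x y. x \<bullet> y = (e \<bullet> x) * (e \<bullet> y) + (v \<bullet> x) * (v \<bullet> y) + (\<Sum>w\<in>W. (w \<bullet> x) * (w \<bullet> y))"
    using orthonormal_pair_extension[OF assms(1-3)] by blast
  have "(\<Sum>w\<in>W. (w \<bullet> x) * (w \<bullet> x)) \<ge> 0" by (intro sum_nonneg) simp
  then have "(e \<bullet> x)\<^sup>2 + (v \<bullet> x)\<^sup>2 \<le> 1"
    using W(2)[of x x] assms(4) by (simp add: norm_eq_1 power2_eq_square)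
  then show ?thesis by (simp add: iso_form_def cmod_def)
qed

text \<open>Up to a nonzero constant this is the coefficient of s in the (k+1)-st power of the
  quadratic.\<close>

lemma iso_span_orthogonal_mult:
  assumes e: "norm e = 1" and v: "norm v = 1" "v \<bullet> e = 0" and w: "norm w = 1" "w \<bullet> e = 0" "w \<bullet> v = 0"
  shows "(\<lambda>x. of_real (w \<bullet> x) * iso_form e v x ^ k) \<in> iso_span e"
proof -
  have "(\<lambda>x. coeff ([:iso_form e v x, 2 * \<i> * of_real (w \<bullet> x), cnj (iso_form e v x):] ^ Suc k) 1) \<in> iso_span e"
    by (rule iso_span_quadratic[OF assms]) simp
  then have "(\<lambda>x. (of_nat (Suc k) * 2 * \<i>) * (of_real (w \<bullet> x) * iso_form e v x ^ k)) \<in> iso_span e"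
    unfolding coeff_quadratic_power by (simp add: algebra_simps)
  then show ?thesis
    by (rule iso_span_scale_cancel) (simp del: of_nat_Suc)
qed

text \<open>For k = 0, conjugation replaces \<open>v\<close> by \<open>- v\<close>. Otherwise the
  doubled coefficients of s^2 in the (k+1)-st powers are summed over \<open>W\<close>, and on the
  sphere the squares \<open>(w \<bullet> x)\<^sup>2\<close> add up to 1 - |z|^2.\<close>

lemma iso_span_cnj_mult:
  assumes e: "norm e = 1" and v: "norm v = 1" "v \<bullet> e = 0"
  shows "(\<lambda>x. cnj (iso_form e v x) * iso_form e v x ^ k) \<in> iso_span e"
proof (cases k)
  case 0
  have "(\<lambda>x. iso_form e (- v) x ^ 1) \<in> iso_span e"
    using v by (intro iso_span.power) auto
  moreover have "iso_form e (- v) x = cnj (iso_form e v x)" for x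
    by (simp add: iso_form_def complex_eq_iff)
  ultimately show ?thesis using 0 by simp
next
  case (Suc k')
  define z where "z = iso_form e v"
  obtain W where W: "finite W" "\<And>w. w \<in> W \<Longrightarrow> norm w = 1 \<and> w \<bullet> e = 0 \<and> w \<bullet> v = 0"
    "\<And>x y. x \<bullet> y = (e \<bullet> x) * (e \<bullet> y) + (v \<bullet> x) * (v \<bullet> y) + (\<Sum>w\<in>W. (w \<bullet> x) * (w \<bullet> y))"
    using orthonormal_pair_extension[OF assms] by blast
  define c d :: complex where "c = of_nat (Suc (Suc k'))" and "d = of_nat (Suc k' * Suc (Suc k'))"
  define A where "A w x = 2 * c * z x ^ Suc k' * cnj (z x) + d * z x ^ k' * (2 * \<i> * of_real (w \<bullet> x))\<^sup>2" for w x
  have A: "A w \<in> iso_span e" if "w \<in> W" for w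
  proof -
    have "(\<lambda>x. 2 * coeff ([:z x, 2 * \<i> * of_real (w \<bullet> x), cnj (z x):] ^ Suc (Suc k')) 2) \<in> iso_span e"
      unfolding z_def
      by (intro iso_span.scale iso_span_quadratic) (use W(2)[OF that] assms in auto)
    then show ?thesis unfolding coeff_quadratic_power A_def c_def d_def by simp
  qed
  \<comment> \<open>Since (2 i)^2 = -4, replacing the sum of squares by 1 - |z|^2 leaves - 4 d z^k',
    which the added term cancels.\<close>
  have "(\<lambda>x. (\<Sum>w\<in>W. A w x) + 4 * d * z x ^ k') \<in> iso_span e"
    unfolding z_def
    by (intro iso_span.add iso_span.scale iso_span.power iso_span_sum[OF v]) (use A v in auto)
  then have "(\<lambda>x. (2 * of_nat (card W) * c + 4 * d) * (cnj (z x) * z x ^ k)) \<in> iso_span e"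
  proof (rule iso_span.cong)
    fix x :: 'a assume "x \<in> sphere 0 1"
    then have "x \<bullet> x = 1" by (simp add: norm_eq_1)
    then have "(\<Sum>w\<in>W. (w \<bullet> x)\<^sup>2) = 1 - (cmod (z x))\<^sup>2"
      using W(3)[of x x] by (simp add: z_def iso_form_def cmod_def power2_eq_square)
    from arg_cong[OF this, of complex_of_real]
    have eq: "(\<Sum>w\<in>W. (of_real (w \<bullet> x))\<^sup>2) = 1 - z x * cnj (z x)"
      unfolding complex_norm_square[symmetric] by simp
    have "(\<Sum>w\<in>W. A w x) = of_nat (card W) * (2 * c * z x ^ Suc k' * cnj (z x))
        - 4 * d * z x ^ k' * (\<Sum>w\<in>W. (of_real (w \<bullet> x))\<^sup>2)"
      by (simp add: A_def sum.distrib sum_subtractf sum_distrib_left power_mult_distrib mult_ac)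
    then show "(\<Sum>w\<in>W. A w x) + 4 * d * z x ^ k' = (2 * of_nat (card W) * c + 4 * d) * (cnj (z x) * z x ^ k)"
      unfolding eq Suc by (simp add: algebra_simps)
  qed
  \<comment> \<open>Both contributions are natural numbers and the second is positive, so the
    constant is nonzero even for empty \<open>W\<close>.\<close>
  moreover have "2 * of_nat (card W) * c + 4 * d \<noteq> 0"
  proof -
    have "2 * of_nat (card W) * c + 4 * d = of_nat (2 * card W * Suc (Suc k') + 4 * (Suc k' * Suc (Suc k')))"
      by (simp add: c_def d_def algebra_simps)
    also have "\<dots> \<noteq> 0" unfolding of_nat_eq_0_iff by simp
    finally show ?thesis .
  qed
  ultimately show ?thesis unfolding z_def by (rule iso_span_scale_cancel)
qed

text \<open>Expand \<open>u \<bullet> x\<close> by Parseval into the real and imaginary parts of z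
  and the \<open>w \<bullet> x\<close>. Times z^k, these are covered by z^(k+1),
  \<open>iso_span_cnj_mult\<close> and \<open>iso_span_orthogonal_mult\<close>.\<close>

lemma iso_span_inner_mult:
  assumes e: "norm e = 1" and F: "F \<in> iso_span e"
  shows "(\<lambda>x. of_real (u \<bullet> x) * F x) \<in> iso_span e"
  using F
proof induction
  case (power v k)
  define z where "z = iso_form e v"
  obtain W where W: "finite W" "\<And>w. w \<in> W \<Longrightarrow> norm w = 1 \<and> w \<bullet> e = 0 \<and> w \<bullet> v = 0"
    "\<And>x y. x \<bullet> y = (e \<bullet> x) * (e \<bullet> y) + (v \<bullet> x) * (v \<bullet> y) + (\<Sum>w\<in>W. (w \<bullet> x) * (w \<bullet> y))"
    using orthonormal_pair_extension[OF e power] by blast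
  have "(\<lambda>x. (of_real (e \<bullet> u) / 2) * (z x ^ Suc k + cnj (z x) * z x ^ k)
          + (of_real (v \<bullet> u) / (2 * \<i>)) * (z x ^ Suc k - cnj (z x) * z x ^ k)
          + (\<Sum>w\<in>W. of_real (w \<bullet> u) * (of_real (w \<bullet> x) * z x ^ k))) \<in> iso_span e"
    unfolding z_def
    by (intro iso_span.add iso_span.scale iso_span_diff iso_span.power iso_span_cnj_mult
        iso_span_sum[OF power] iso_span_orthogonal_mult) (use e power W(2) in auto)
  then show ?case
  proof (rule iso_span.cong)
    fix x :: 'a
    have re: "(z x + cnj (z x)) / 2 = of_real (e \<bullet> x)" and im: "(z x - cnj (z x)) / (2 * \<i>) = of_real (v \<bullet> x)"
      by (simp_all add: z_def iso_form_def complex_eq_iff)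
    have "of_real (u \<bullet> x) = of_real (e \<bullet> u) * of_real (e \<bullet> x) + of_real (v \<bullet> u) * of_real (v \<bullet> x)
        + (\<Sum>w\<in>W. of_real (w \<bullet> u) * (of_real (w \<bullet> x) :: complex))"
      unfolding W(3)[of u x] by simp
    then show "(of_real (e \<bullet> u) / 2) * (z x ^ Suc k + cnj (z x) * z x ^ k)
          + (of_real (v \<bullet> u) / (2 * \<i>)) * (z x ^ Suc k - cnj (z x) * z x ^ k)
          + (\<Sum>w\<in>W. of_real (w \<bullet> u) * (of_real (w \<bullet> x) * z x ^ k))
        = of_real (u \<bullet> x) * iso_form e v x ^ k"
      unfolding re[symmetric] im[symmetric] z_def[symmetric]
      by (simp add: ring_distribs sum_distrib_left mult_ac add_divide_distrib diff_divide_distrib)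
  qed
next
  case (add F G)
  from iso_span.add[OF add.IH] show ?case by (simp add: ring_distribs)
next
  case (scale F c)
  from iso_span.scale[OF scale.IH, of c] show ?case by (simp add: mult.left_commute)
next
  case (cong F G)
  from iso_span.cong[OF cong.IH] show ?case using cong.hyps(2) by simp
qed

lemma iso_span_polynomial_mult:
  fixes p :: "'a::euclidean_space \<Rightarrow> real"
  assumes e: "norm e = 1" and "real_polynomial_function p" "F \<in> iso_span e"
  shows "(\<lambda>x. of_real (p x) * F x) \<in> iso_span e"
  using assms(2,3)
proof (induction arbitrary: F)
  case (linear f)
  \<comment> \<open>The Riesz vector of the functional \<open>f\<close>.\<close>
  define u where "u = adjoint f 1"
  have "f x = u \<bullet> x" for x
    using adjoint_works[OF bounded_linear.linear[OF linear.hyps], of x 1] by (simp add: u_def inner_commute)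
  then show ?case using iso_span_inner_mult[OF e linear.prems, of u] by simp
next
  case (const c)
  then show ?case by (rule iso_span.scale)
next
  case (add f g)
  from iso_span.add[OF add.IH(1)[OF add.prems] add.IH(2)[OF add.prems]] show ?case
    by (simp add: ring_distribs)
next
  case (mult f g)
  from mult.IH(1)[OF mult.IH(2)[OF mult.prems]] show ?case by (simp add: mult.assoc)
qed

text \<open>Multiply the constant 1, a zeroth power, by \<open>p\<close>. The dimension bound
  supplies an admissible \<open>v\<close>.\<close>

lemma real_polynomial_in_iso_span:
  fixes e :: "'a::euclidean_space"
  assumes "DIM('a) \<ge> 2" "norm e = 1" "real_polynomial_function p"
  shows "(\<lambda>x. of_real (p x)) \<in> iso_span e"
proof -
  obtain y where y: "y \<noteq> 0" "orthogonal e y" by (rule orthogonal_to_vector_exists[OF assms(1)])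
  have "(\<lambda>x. iso_form e (sgn y) x ^ 0) \<in> iso_span e"
    by (rule iso_span.power) (use y in \<open>auto simp: norm_sgn sgn_div_norm orthogonal_def inner_commute\<close>)
  from iso_span_polynomial_mult[OF assms(2,3) this] show ?thesis by simp
qed

subsection \<open>Polynomials in one complex variable vanishing to high order\<close>

text \<open>Factor out the geometric sum. Passing from a factor r close to 1 to its k-th power thus
  costs only a constant depending on k.\<close>

lemma norm_one_minus_power_le:
  fixes r :: complex
  assumes "norm r \<le> 2"
  shows "norm (1 - r ^ k) \<le> norm (1 - r) * (real k * 2 ^ k)"
proof -
  have "norm (\<Sum>i<k. r ^ i) \<le> (\<Sum>i<k. 2 ^ k)"
  proof (rule sum_norm_le)
    fix i assume "i \<in> {..<k}"
    have "norm (r ^ i) \<le> 2 ^ i" using assms by (simp add: norm_power power_mono)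
    also have "\<dots> \<le> (2::real) ^ k" using \<open>i \<in> {..<k}\<close> by (intro power_increasing) auto
    finally show "norm (r ^ i) \<le> 2 ^ k" .
  qed
  then show ?thesis
    unfolding one_diff_power_eq norm_mult by (intro mult_left_mono) auto
qed

text \<open>Take z^j (1 - (z/R)^N)^k: the bracket vanishes at R, while |z/R|^N is at most R^(-N) on
  the disc and so tends to 0 uniformly.\<close>

lemma ex_poly_approx_outside:
  assumes "R > 1" "\<epsilon> > 0"
  shows "\<exists>H. [:- of_real R, 1:] ^ k dvd H \<and> (\<forall>z::complex. norm z \<le> 1 \<longrightarrow> norm (z ^ j - poly H z) < \<epsilon>)"
proof -
  have "(\<lambda>N. inverse R ^ N * (real k * 2 ^ k)) \<longlonglongrightarrow> 0"
    by (intro tendsto_mult_left_zero LIMSEQ_power_zero) (use assms in \<open>auto simp: field_simps\<close>)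
  from order_tendstoD(2)[OF this assms(2)]
  obtain N where N: "inverse R ^ N * (real k * 2 ^ k) < \<epsilon>"
    by (auto simp: eventually_sequentially)
  define u :: "complex poly" where "u = monom (inverse (of_real R) ^ N) N"
  define H where "H = monom 1 j * (1 - u) ^ k"
  have pu: "poly u z = (inverse (of_real R) * z) ^ N" for z
    by (simp add: u_def poly_monom power_mult_distrib)
  have "[:- of_real R, 1:] dvd 1 - u"
    unfolding poly_eq_0_iff_dvd[symmetric] using assms by (simp add: pu)
  then have "[:- of_real R, 1:] ^ k dvd H"
    unfolding H_def by (intro dvd_mult dvd_power_same)
  moreover have "norm (z ^ j - poly H z) < \<epsilon>" if z: "norm z \<le> 1" for z
  proof -
    have nu: "norm (poly u z) \<le> inverse R ^ N"
      unfolding pu norm_power norm_mult using z assms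
      by (intro power_mono) (auto simp: norm_inverse mult_left_le)
    have "inverse R ^ N \<le> 1" using assms by (intro power_le_one) (auto simp: field_simps)
    then have "norm (1 - poly u z) \<le> 2"
      using norm_triangle_ineq4[of 1 "poly u z"] nu by simp
    then have "norm (1 - (1 - poly u z) ^ k) \<le> norm (1 - (1 - poly u z)) * (real k * 2 ^ k)"
      by (rule norm_one_minus_power_le)
    also have "\<dots> \<le> inverse R ^ N * (real k * 2 ^ k)"
      using nu by (intro mult_right_mono) auto
    finally have *: "norm (1 - (1 - poly u z) ^ k) < \<epsilon>" using N by simp
    have "z ^ j - poly H z = z ^ j * (1 - (1 - poly u z) ^ k)"
      by (simp add: H_def poly_monom poly_power algebra_simps)
    then have "norm (z ^ j - poly H z) = norm z ^ j * norm (1 - (1 - poly u z) ^ k)"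
      by (simp add: norm_mult norm_power)
    also have "\<dots> \<le> 1 * norm (1 - (1 - poly u z) ^ k)"
      using z by (intro mult_right_mono power_le_one) auto
    finally show ?thesis using * by simp
  qed
  ultimately show ?thesis by blast
qed

text \<open>The factor $r = 1 - (1 + z + \dots + z^{N-1})/N$ vanishes at \<open>1\<close>, while
  $(z - 1)(1 - r) = (z^N - 1)/N$ is uniformly small on the disc.\<close>
lemma ex_poly_approx_boundary:
  assumes "\<epsilon> > 0"
  shows "\<exists>H. [:- 1, 1:] ^ k dvd H \<and> (\<forall>z::complex. norm z \<le> 1 \<longrightarrow> norm (z ^ j - 1 - poly H z) < \<epsilon>)"
proof -
  \<comment> \<open>The threshold is read off from the final estimate below; the \<open>max\<close>
    with 0 forces \<open>N > 0\<close>.\<close>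
  obtain N where N: "2 * (real j * (real k * 2 ^ k)) / \<epsilon> < real N" "N > 0"
    using reals_Archimedean2[of "max 0 (2 * (real j * (real k * 2 ^ k)) / \<epsilon>)"] by (auto simp: max_def split: if_splits)
  define a :: "complex poly" where "a = smult (inverse (of_nat N)) (\<Sum>i<N. monom 1 i)"
  define H where "H = (monom 1 j - 1) * (1 - a) ^ k"
  have pa: "poly a z = (\<Sum>i<N. z ^ i) / of_nat N" for z
    by (simp add: a_def poly_sum poly_monom divide_inverse)
  have "[:- 1, 1:] dvd 1 - a"
    unfolding poly_eq_0_iff_dvd[symmetric] using N by (simp add: pa)
  then have "[:- 1, 1:] ^ k dvd H"
    unfolding H_def by (intro dvd_mult dvd_power_same)
  moreover have "norm (z ^ j - 1 - poly H z) < \<epsilon>" if z: "norm z \<le> 1" for z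
  proof -
    have geo: "norm (\<Sum>i<n. z ^ i) \<le> real n" for n
      using sum_norm_le[of "{..<n}" "\<lambda>i. z ^ i" "\<lambda>_. 1"] z by (auto simp: norm_power power_le_one)
    have na: "norm (poly a z) \<le> 1"
      using geo[of N] N(2) by (simp add: pa norm_divide divide_le_eq)
    then have r: "norm (1 - poly a z) \<le> 2"
      using norm_triangle_ineq4[of 1 "poly a z"] by simp
    have "(z - 1) * poly a z = (z ^ N - 1) / of_nat N"
      by (simp add: pa power_diff_1_eq)
    moreover have "norm (z ^ N - 1) \<le> 2"
      using norm_triangle_ineq4[of "z ^ N" 1] power_le_one[of "norm z" N] z by (simp add: norm_power)
    ultimately have sm: "norm (z - 1) * norm (poly a z) \<le> 2 / real N"
      unfolding norm_mult[symmetric] by (simp add: norm_divide divide_right_mono)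
    have "z ^ j - 1 - poly H z = (z ^ j - 1) * (1 - (1 - poly a z) ^ k)"
      by (simp add: H_def poly_monom poly_power algebra_simps)
    \<comment> \<open>The factor z^j - 1 supplies the z - 1 that makes \<open>poly a z\<close>
      small; the remaining quotient is bounded by j.\<close>
    also have "\<dots> = (\<Sum>i<j. z ^ i) * ((z - 1) * (1 - (1 - poly a z) ^ k))"
      by (simp add: power_diff_1_eq)
    finally have "norm (z ^ j - 1 - poly H z)
        = norm (\<Sum>i<j. z ^ i) * (norm (z - 1) * norm (1 - (1 - poly a z) ^ k))"
      by (simp add: norm_mult)
    also have "\<dots> \<le> real j * (norm (z - 1) * (norm (poly a z) * (real k * 2 ^ k)))"
      using norm_one_minus_power_le[OF r, of k] geo[of j]
      by (intro mult_mono mult_left_mono) auto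
    also have "\<dots> = (norm (z - 1) * norm (poly a z)) * (real j * (real k * 2 ^ k))"
      by simp
    also have "\<dots> \<le> (2 / real N) * (real j * (real k * 2 ^ k))"
      using sm by (intro mult_right_mono) auto
    also have "\<dots> < \<epsilon>"
      using N assms by (simp add: field_simps)
    finally show ?thesis .
  qed
  ultimately show ?thesis by blast
qed

subsection \<open>Harmonic polynomials built from isotropic linear forms\<close>

text \<open>Keeping the pairs in a list lets differentiation act on the list, so that vanishing at a
  point can be tracked as divisibility of the polynomials.\<close>

definition iso_sum :: "'a::euclidean_space \<Rightarrow> ('a \<times> complex poly) list \<Rightarrow> 'a \<Rightarrow> complex" where
  "iso_sum e ps x = (\<Sum>(v, H)\<leftarrow>ps. poly H (iso_form e v x))"

text \<open>The chain rule: along axis \<open>i\<close> the linear form has the constant derivative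
  \<open>Complex (e $ i) (v $ i)\<close>.\<close>

definition iso_partial :: "real ^ 'n \<Rightarrow> 'n \<Rightarrow> ((real ^ 'n) \<times> complex poly) list \<Rightarrow> ((real ^ 'n) \<times> complex poly) list"
  where "iso_partial e i ps = map (\<lambda>(v, H). (v, smult (Complex (e $ i) (v $ i)) (pderiv H))) ps"

definition vanishing_pairs :: "'a::euclidean_space \<Rightarrow> real \<Rightarrow> nat \<Rightarrow> ('a \<times> complex poly) list \<Rightarrow> bool" where
  "vanishing_pairs e R k ps \<longleftrightarrow>
     (\<forall>(v, H)\<in>set ps. norm v = 1 \<and> v \<bullet> e = 0 \<and> [:- of_real R, 1:] ^ k dvd H)"

lemma iso_sum_Nil [simp]: "iso_sum e [] x = 0"
  and iso_sum_Cons [simp]: "iso_sum e ((v, H) # ps) x = poly H (iso_form e v x) + iso_sum e ps x"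
  and iso_sum_append [simp]: "iso_sum e (ps @ qs) x = iso_sum e ps x + iso_sum e qs x"
  by (simp_all add: iso_sum_def)

lemma iso_partial_Nil [simp]: "iso_partial e i [] = []"
  and iso_partial_Cons [simp]: "iso_partial e i ((v, H) # ps) =
        (v, smult (Complex (e $ i) (v $ i)) (pderiv H)) # iso_partial e i ps"
  by (simp_all add: iso_partial_def)

lemma iso_sum_has_derivative_axis:
  "((\<lambda>t. Re (iso_sum e ps (x + t *\<^sub>R axis i 1))) has_real_derivative
      Re (iso_sum e (iso_partial e i ps) x)) (at 0)"
proof (induction ps)
  case (Cons p ps)
  obtain v H where p: "p = (v, H)" by force
  define z a where "z = iso_form e v x" and "a = Complex (e $ i) (v $ i)"
  have line: "iso_form e v (x + t *\<^sub>R axis i 1) = z + of_real t * a" for t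
    by (simp add: iso_form_def z_def a_def complex_eq_iff inner_add_right inner_axis)
  have "((\<lambda>w. poly H (z + w * a)) has_field_derivative poly (pderiv H) (z + of_real 0 * a) * a) (at (of_real 0))"
    by (rule DERIV_chain2[OF poly_DERIV]) (auto intro!: derivative_eq_intros)
  from has_vector_derivative_real_field[OF this]
  have "((\<lambda>t. Re (poly H (z + of_real t * a))) has_real_derivative Re (poly (pderiv H) (z + of_real 0 * a) * a)) (at 0)"
    by (rule has_field_derivative_Re)
  from DERIV_add[OF this Cons.IH] show ?case
    by (simp add: p line mult.commute flip: z_def a_def)
qed simp

lemma partial_deriv_iso_sum:
  "partial_deriv i (\<lambda>x. Re (iso_sum e ps x)) = (\<lambda>x. Re (iso_sum e (iso_partial e i ps) x))"
  unfolding partial_deriv_def by (intro ext DERIV_imp_deriv iso_sum_has_derivative_axis)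

lemma iterated_partial_iso_sum:
  "iterated_partial is (\<lambda>x. Re (iso_sum e ps x)) = (\<lambda>x. Re (iso_sum e (foldr (iso_partial e) is ps) x))"
  by (induction "is") (simp_all add: iterated_partial_def partial_deriv_iso_sum)

text \<open>Each summand contributes its second derivative times the sum of the squares of e_i + i
  v_i, which is |e|^2 - |v|^2 + 2 i (v \<bullet> e) = 0.\<close>

lemma laplacian_iso_sum:
  assumes "norm e = 1" "vanishing_pairs e R k ps"
  shows "laplacian (\<lambda>x. Re (iso_sum e ps x)) x = 0"
proof -
  have "(\<Sum>i\<in>UNIV. iso_sum e (iso_partial e i (iso_partial e i ps)) x) = 0"
    using assms(2)
  proof (induction ps)
    case (Cons p ps)
    obtain v H where p: "p = (v, H)" by force
    have v: "norm v = 1" "v \<bullet> e = 0" using Cons.prems by (auto simp: p vanishing_pairs_def)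
    have "(\<Sum>i\<in>UNIV. (Complex (e $ i) (v $ i))\<^sup>2) = Complex (e \<bullet> e - v \<bullet> v) (2 * (v \<bullet> e))"
      by (simp add: complex_eq_iff power2_eq_square inner_vec_def sum_subtractf sum_distrib_left mult.commute)
    also have "\<dots> = 0" using v assms(1) by (simp add: norm_eq_1 complex_eq_iff)
    finally have "(\<Sum>i\<in>UNIV. (Complex (e $ i) (v $ i))\<^sup>2 * poly (pderiv (pderiv H)) (iso_form e v x)) = 0"
      by (simp flip: sum_distrib_right)
    moreover have "(\<Sum>i\<in>UNIV. iso_sum e (iso_partial e i (iso_partial e i ps)) x) = 0"
      using Cons by (auto simp: vanishing_pairs_def)
    ultimately show ?case
      by (simp add: p pderiv_smult sum.distrib power2_eq_square mult.assoc)
  qed simp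
  then show ?thesis
    by (simp add: laplacian_def partial_deriv_iso_sum flip: Re_sum)
qed

lemma dvd_pderiv_of_power_dvd:
  fixes q :: "'a::idom poly"
  assumes "q ^ Suc k dvd H"
  shows "q ^ k dvd pderiv H"
proof -
  obtain r where "H = q ^ Suc k * r" using assms by (elim dvdE)
  then have "pderiv H = q ^ k * (q * pderiv r + smult (of_nat (Suc k)) (pderiv q) * r)"
    by (simp only: pderiv_mult pderiv_power_Suc) (simp add: algebra_simps del: of_nat_Suc)
  then show ?thesis by simp
qed

text \<open>Each differentiation costs at most one order of the root R.\<close>

lemma vanishing_pairs_iso_partial:
  assumes "vanishing_pairs e R (Suc k) ps"
  shows "vanishing_pairs e R k (iso_partial e i ps)"
  using assms unfolding vanishing_pairs_def iso_partial_def
  by (auto intro!: dvd_smult dvd_pderiv_of_power_dvd simp del: power_Suc)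

lemma vanishing_pairs_foldr_iso_partial:
  assumes "vanishing_pairs e R (length is + k) ps"
  shows "vanishing_pairs e R k (foldr (iso_partial e) is ps)"
  using assms
proof (induction "is" arbitrary: k)
  case (Cons i "is")
  have "vanishing_pairs e R (Suc k) (foldr (iso_partial e) is ps)"
    by (rule Cons.IH) (use Cons.prems in simp)
  then show ?case by (simp add: vanishing_pairs_iso_partial)
qed simp

text \<open>Every admissible form takes the value R at \<open>R *\<^sub>R e\<close>, so one factor z
  - R in each polynomial suffices.\<close>

lemma iso_sum_at_zero:
  assumes "norm e = 1" "vanishing_pairs e R (Suc k) ps"
  shows "iso_sum e ps (R *\<^sub>R e) = 0"
  using assms(2)
proof (induction ps)
  case (Cons p ps)
  obtain v H where p: "p = (v, H)" by force
  have vH: "v \<bullet> e = 0" "[:- of_real R, 1:] ^ Suc k dvd H" using Cons.prems by (auto simp: p vanishing_pairs_def)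
  have "[:- of_real R, 1:] dvd H"
    using vH(2) by (rule dvd_trans[OF dvd_power, rotated]) simp
  then have "poly H (of_real R) = 0" by (simp add: poly_eq_0_iff_dvd)
  moreover have "iso_form e v (R *\<^sub>R e) = of_real R"
    using assms(1) vH by (simp add: iso_form_def complex_eq_iff norm_eq_1)
  ultimately show ?case using Cons by (auto simp: p vanishing_pairs_def)
qed simp

lemma real_polynomial_function_iso_sum:
  "real_polynomial_function (\<lambda>x. Re (iso_sum e ps x))"
proof (induction ps)
  case (Cons p ps)
  obtain v H where p: "p = (v, H)" by force
  \<comment> \<open>Both parts go through one induction, because complex multiplication mixes
    them.\<close>
  have "real_polynomial_function (\<lambda>x. Re (poly H (iso_form e v x))) \<and>
        real_polynomial_function (\<lambda>x. Im (poly H (iso_form e v x)))"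
  proof (induction H)
    case (pCons a H)
    have "real_polynomial_function (\<lambda>x. e \<bullet> x)" "real_polynomial_function (\<lambda>x. v \<bullet> x)"
      by (auto intro!: real_polynomial_function.intros(1) bounded_linear_inner_right)
    then show ?case using pCons.IH
      by (auto simp: iso_form_def
          intro!: real_polynomial_function.intros(2-4) real_polynomial_function_diff)
  qed auto
  then show ?case using Cons by (auto simp: p)
qed auto

lemma iso_sum_in_harmonic_polys_vanishing:
  assumes "norm e = 1" "vanishing_pairs e R (Suc m) ps"
  shows "(\<lambda>x. Re (iso_sum e ps x)) \<in> harmonic_polys_vanishing (R *\<^sub>R e) m"
proof -
  have "iso_sum e (foldr (iso_partial e) is ps) (R *\<^sub>R e) = 0" if "length is \<le> m" for "is"
  proof (rule iso_sum_at_zero[OF assms(1) vanishing_pairs_foldr_iso_partial])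
    \<comment> \<open>Of the m + 1 orders at least one survives after at most m derivatives.\<close>
    show "vanishing_pairs e R (length is + Suc (m - length is)) ps" using assms(2) that by simp
  qed
  then show ?thesis
    using laplacian_iso_sum[OF assms] real_polynomial_function_iso_sum
    by (auto simp: harmonic_polys_vanishing_def harmonic_polynomial_def iterated_partial_iso_sum)
qed

section \<open>Uniform approximation on the sphere\<close>

definition iso_approximable :: "'a::euclidean_space \<Rightarrow> real \<Rightarrow> nat \<Rightarrow> ('a \<Rightarrow> complex) \<Rightarrow> bool" where
  "iso_approximable e R k F \<longleftrightarrow>
     (\<forall>\<epsilon>>0. \<exists>ps. vanishing_pairs e R k ps \<and> (\<forall>x\<in>sphere 0 1. norm (F x - iso_sum e ps x) < \<epsilon>))"

lemma iso_approximable_add: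
  assumes "iso_approximable e R k F" "iso_approximable e R k G"
  shows "iso_approximable e R k (\<lambda>x. F x + G x)"
  unfolding iso_approximable_def
proof (intro allI impI)
  fix \<epsilon> :: real assume "\<epsilon> > 0"
  then have "\<epsilon> / 2 > 0" by simp
  then obtain ps qs where ps: "vanishing_pairs e R k ps" "\<forall>x\<in>sphere 0 1. norm (F x - iso_sum e ps x) < \<epsilon> / 2"
    and qs: "vanishing_pairs e R k qs" "\<forall>x\<in>sphere 0 1. norm (G x - iso_sum e qs x) < \<epsilon> / 2"
    using assms unfolding iso_approximable_def by meson
  have "vanishing_pairs e R k (ps @ qs)" using ps(1) qs(1) by (auto simp: vanishing_pairs_def)
  moreover have "norm (F x + G x - iso_sum e (ps @ qs) x) < \<epsilon>" if "x \<in> sphere 0 1" for x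
    using norm_diff_triangle_ineq[of "F x" "G x" "iso_sum e ps x" "iso_sum e qs x"]
      ps(2)[rule_format, OF that] qs(2)[rule_format, OF that] by simp
  ultimately show "\<exists>ps. vanishing_pairs e R k ps \<and> (\<forall>x\<in>sphere 0 1. norm (F x + G x - iso_sum e ps x) < \<epsilon>)"
    by blast
qed

lemma iso_approximable_scale:
  assumes "iso_approximable e R k F"
  shows "iso_approximable e R k (\<lambda>x. c * F x)"
  unfolding iso_approximable_def
proof (intro allI impI)
  fix \<epsilon> :: real assume "\<epsilon> > 0"
  \<comment> \<open>Dividing by \<open>norm c + 1\<close> avoids a separate case for c = 0.\<close>
  moreover have c: "norm c + 1 > 0" by (simp add: add_nonneg_pos)
  ultimately have "\<epsilon> / (norm c + 1) > 0" by simp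
  then obtain ps where ps: "vanishing_pairs e R k ps"
      "\<forall>x\<in>sphere 0 1. norm (F x - iso_sum e ps x) < \<epsilon> / (norm c + 1)"
    using assms unfolding iso_approximable_def by meson
  define qs where "qs = map (\<lambda>(v, H). (v, smult c H)) ps"
  have "iso_sum e qs x = c * iso_sum e ps x" for x
    unfolding qs_def by (induction ps) (auto simp: algebra_simps)
  moreover have "vanishing_pairs e R k qs"
    using ps(1) by (auto simp: vanishing_pairs_def qs_def intro: dvd_smult)
  moreover have "norm (c * F x - c * iso_sum e ps x) < \<epsilon>" if "x \<in> sphere 0 1" for x
  proof -
    have "norm (c * F x - c * iso_sum e ps x) = norm c * norm (F x - iso_sum e ps x)"
      by (simp add: norm_mult flip: right_diff_distrib)
    also have "\<dots> \<le> (norm c + 1) * norm (F x - iso_sum e ps x)"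
      by (intro mult_right_mono) auto
    also have "\<dots> < \<epsilon>" using ps(2)[rule_format, OF that] c by (simp add: field_simps)
    finally show ?thesis .
  qed
  ultimately show "\<exists>ps. vanishing_pairs e R k ps \<and> (\<forall>x\<in>sphere 0 1. norm (c * F x - iso_sum e ps x) < \<epsilon>)"
    by auto
qed

lemma iso_approximable_cong:
  assumes "\<And>x. x \<in> sphere 0 1 \<Longrightarrow> F x = G x" "iso_approximable e R k F"
  shows "iso_approximable e R k G"
  using assms by (simp add: iso_approximable_def)

lemma iso_approximable_iso_form:
  assumes "norm e = 1" "norm v = 1" "v \<bullet> e = 0"
    and "\<And>\<epsilon>. \<epsilon> > 0 \<Longrightarrow> \<exists>H. [:- of_real R, 1:] ^ k dvd H \<and> (\<forall>z. norm z \<le> 1 \<longrightarrow> norm (g z - poly H z) < \<epsilon>)"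
  shows "iso_approximable e R k (\<lambda>x. g (iso_form e v x))"
  unfolding iso_approximable_def
proof (intro allI impI)
  fix \<epsilon> :: real assume "\<epsilon> > 0"
  then obtain H where H: "[:- of_real R, 1:] ^ k dvd H" "\<And>z. norm z \<le> 1 \<Longrightarrow> norm (g z - poly H z) < \<epsilon>"
    using assms(4) by metis
  have "vanishing_pairs e R k [(v, H)]" using H(1) assms by (simp add: vanishing_pairs_def)
  moreover have "norm (g (iso_form e v x) - iso_sum e [(v, H)] x) < \<epsilon>" if "x \<in> sphere 0 1" for x
    using H(2)[OF norm_iso_form_le] assms that by simp
  ultimately show "\<exists>ps. vanishing_pairs e R k ps \<and> (\<forall>x\<in>sphere 0 1. norm (g (iso_form e v x) - iso_sum e ps x) < \<epsilon>)"
    by blast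
qed

lemma iso_span_approximable_outside:
  assumes "norm e = 1" "R > 1" "F \<in> iso_span e"
  shows "iso_approximable e R k F"
  using assms(3)
proof induction
  case (power v j)
  show ?case
    by (rule iso_approximable_iso_form[OF assms(1) power, where g = "\<lambda>z. z ^ j"])
       (rule ex_poly_approx_outside[OF assms(2)])
next
  case (cong F G)
  show ?case by (rule iso_approximable_cong[OF cong.hyps(2) cong.IH])
next
  case (add F G)
  show ?case by (rule iso_approximable_add[OF add.IH])
next
  case (scale F c)
  show ?case by (rule iso_approximable_scale[OF scale.IH])
qed

text \<open>For R = 1 all approximants vanish at \<open>e\<close>, so the value there is subtracted.
  This correction is linear in \<open>F\<close> and turns a generator into z^j - 1, as z_v(e) =
  1.\<close>

lemma iso_span_approximable_boundary:
  assumes "norm e = 1" "F \<in> iso_span e"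
  shows "iso_approximable e 1 k (\<lambda>x. F x - F e)"
  using assms(2)
proof induction
  case (power v j)
  have "iso_form e v e = 1" using assms(1) power by (simp add: iso_form_def complex_eq_iff norm_eq_1)
  moreover have "iso_approximable e 1 k (\<lambda>x. iso_form e v x ^ j - 1)"
    by (rule iso_approximable_iso_form[OF assms(1) power, where g = "\<lambda>z. z ^ j - 1"])
       (use ex_poly_approx_boundary in simp)
  ultimately show ?case by simp
next
  case (add F G)
  from iso_approximable_add[OF add.IH] show ?case by (simp add: algebra_simps)
next
  case (scale F c)
  from iso_approximable_scale[OF scale.IH, of c] show ?case by (simp add: algebra_simps)
next
  case (cong F G)
  have "F e = G e" using cong.hyps(2) assms(1) by simp
  then show ?case using cong.hyps(2) by (intro iso_approximable_cong[OF _ cong.IH]) simp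
qed

lemma harmonic_polys_vanishing_approx:
  fixes x0 :: "real ^ 'n"
  assumes "CARD('n) \<ge> 2" "norm x0 \<ge> 1" "continuous_on (sphere 0 1) f" "x0 \<in> sphere 0 1 \<longrightarrow> f x0 = 0" "\<epsilon> > 0"
  obtains p where "p \<in> harmonic_polys_vanishing x0 m" "\<And>x. x \<in> sphere 0 1 \<Longrightarrow> \<bar>f x - p x\<bar> < \<epsilon>"
proof -
  define e R where "e = sgn x0" and "R = norm x0"
  have x0: "x0 \<noteq> 0" using assms(2) by auto
  then have e: "norm e = 1" and x0_eq: "x0 = R *\<^sub>R e"
    by (simp_all add: e_def R_def norm_sgn sgn_div_norm)
  have "\<epsilon> / 3 > 0" using assms(5) by simp
  then obtain q where q: "real_polynomial_function q" "\<And>x. x \<in> sphere 0 1 \<Longrightarrow> \<bar>f x - q x\<bar> < \<epsilon> / 3"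
    using Stone_Weierstrass_real_polynomial_function[OF compact_sphere assms(3)] by metis
  have q_span: "(\<lambda>x. of_real (q x)) \<in> iso_span e"
    by (rule real_polynomial_in_iso_span) (use assms(1) e q in auto)
  \<comment> \<open>On the sphere, \<open>q\<close> need not vanish at x0 = e. The correction stays
    below \<epsilon>/3 because \<open>f\<close> does vanish there.\<close>
  define c where "c = (if R = 1 then q e else 0)"
  have "iso_approximable e R (Suc m) (\<lambda>x. of_real (q x) - of_real c)"
  proof (cases "R = 1")
    case True
    then show ?thesis using iso_span_approximable_boundary[OF e q_span] by (simp add: c_def)
  next
    case False
    then show ?thesis using iso_span_approximable_outside[OF e _ q_span] assms(2) by (simp add: c_def R_def)
  qed
  then obtain ps where ps: "vanishing_pairs e R (Suc m) ps"
      "\<And>x. x \<in> sphere 0 1 \<Longrightarrow> norm (of_real (q x) - of_real c - iso_sum e ps x) < \<epsilon> / 3"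
    using \<open>\<epsilon> / 3 > 0\<close> unfolding iso_approximable_def by meson
  have c: "\<bar>c\<bar> < \<epsilon> / 3"
  proof (cases "R = 1")
    case True
    then have "x0 = e" "e \<in> sphere 0 1" using x0_eq e by auto
    then show ?thesis using q(2)[of e] assms(4) True by (simp add: c_def)
  qed (use assms(5) in \<open>simp add: c_def\<close>)
  show thesis
  proof (rule that)
    show "(\<lambda>x. Re (iso_sum e ps x)) \<in> harmonic_polys_vanishing x0 m"
      using iso_sum_in_harmonic_polys_vanishing[OF e ps(1)] by (simp add: x0_eq)
    fix x :: "real ^ 'n" assume x: "x \<in> sphere 0 1"
    have "\<bar>Re (of_real (q x) - of_real c - iso_sum e ps x)\<bar> < \<epsilon> / 3"
      by (rule le_less_trans[OF abs_Re_le_cmod ps(2)[OF x]])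
    then show "\<bar>f x - Re (iso_sum e ps x)\<bar> < \<epsilon>"
      using q(2)[OF x] c by (simp only: minus_complex.simps Re_complex_of_real)
  qed
qed

subsection \<open>Maximum principle\<close>

text \<open>A polynomial restricted to a line is a polynomial in t, so the derivatives behind
  \<open>deriv\<close> really exist and one-variable calculus applies to them.\<close>

lemma partial_deriv_polynomial_line:
  fixes p :: "real ^ 'n \<Rightarrow> real"
  assumes "real_polynomial_function p"
  shows "\<exists>q'. (\<forall>t. ((\<lambda>t. p (x + t *\<^sub>R axis i 1)) has_real_derivative q' t) (at t)) \<and>
           (q' has_real_derivative partial_deriv i (partial_deriv i p) x) (at 0)"
proof -
  have "polynomial_function (\<lambda>t::real. x + t *\<^sub>R axis i 1)"
    by (intro polynomial_function_add polynomial_function_const polynomial_function_bounded_linear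
        bounded_linear_scaleR_left)
  from real_polynomial_function_compose[OF this assms]
  have "real_polynomial_function (\<lambda>t. p (x + t *\<^sub>R axis i 1))" by (simp add: o_def)
  then obtain q' where q': "real_polynomial_function q'"
      "\<And>t. ((\<lambda>t. p (x + t *\<^sub>R axis i 1)) has_real_derivative q' t) (at t)"
    using has_real_derivative_polynomial_function by blast
  obtain q'' where q'': "\<And>t. (q' has_real_derivative q'' t) (at t)"
    using has_real_derivative_polynomial_function[OF q'(1)] by blast
  have pd: "partial_deriv i p (x + t *\<^sub>R axis i 1) = q' t" for t
  proof -
    have "((\<lambda>s. p (x + (t + s) *\<^sub>R axis i 1)) has_real_derivative q' t) (at 0)"
      using q'(2)[of t] DERIV_shift[of "\<lambda>t. p (x + t *\<^sub>R axis i 1)" "q' t" 0 t] by (simp add: add.commute)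
    then show ?thesis
      unfolding partial_deriv_def by (intro DERIV_imp_deriv) (simp add: scaleR_add_left add.assoc)
  qed
  have "partial_deriv i (partial_deriv i p) x = q'' 0"
    unfolding partial_deriv_def[of i "partial_deriv i p"] pd by (rule DERIV_imp_deriv) (rule q'')
  with q'(2) q'' show ?thesis by metis
qed

text \<open>If D were negative, g' would vanish at 0 and be negative just to its right, and the mean
  value theorem would give a value below \<open>g 0\<close>.\<close>

lemma DERIV_second_nonneg_local_min:
  fixes g :: "real \<Rightarrow> real"
  assumes "\<And>t. (g has_real_derivative g' t) (at t)" "(g' has_real_derivative D) (at 0)"
    and "d > 0" "\<And>t. \<bar>t\<bar> < d \<Longrightarrow> g 0 \<le> g t"
  shows "D \<ge> 0"
proof (rule ccontr)
  assume "\<not> D \<ge> 0"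
  then have "D < 0" by simp
  have "g' 0 = 0"
    by (rule DERIV_local_min[OF assms(1) assms(3)]) (use assms(4) in auto)
  from DERIV_neg_dec_right[OF assms(2) \<open>D < 0\<close>] obtain s where
    s: "s > 0" "\<And>h. h > 0 \<Longrightarrow> h < s \<Longrightarrow> g' h < 0"
    using \<open>g' 0 = 0\<close> by auto
  define h where "h = min s d / 2"
  have h: "h > 0" "h < s" "h < d" using s(1) assms(3) by (auto simp: h_def)
  obtain z where z: "z > 0" "z < h" "g h - g 0 = (h - 0) * g' z"
    using MVT2[OF h(1), of g g'] assms(1) by auto
  have "g h - g 0 < 0" using z s(2)[of z] h by (simp add: mult_pos_neg)
  moreover have "g 0 \<le> g h" using assms(4)[of h] h by simp
  ultimately show False by simp
qed

lemma harmonic_polynomial_minimum_principle: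
  fixes p :: "real ^ 'n \<Rightarrow> real"
  assumes "harmonic_polynomial p" "norm x0 < 1" "p x0 = 0"
  shows "\<exists>x\<in>sphere 0 1. p x \<le> 1 / 2"
proof (rule ccontr)
  assume "\<not> ?thesis"
  then have big: "p x > 1 / 2" if "x \<in> sphere 0 1" for x using that by force
  have poly: "real_polynomial_function p" and harm: "\<And>x. laplacian p x = 0"
    using assms(1) by (auto simp: harmonic_polynomial_def)
  \<comment> \<open>The perturbation makes the principle strict. On the sphere g > 1/2 - 1/4 > 0,
    yet g is at most 0 at x0, so g has an interior minimum. There every second partial derivative of
    p is at least 1/2, contradicting harmonicity.\<close>
  define g where "g x = p x - (1 / 4) * (x \<bullet> x)" for x
  have "continuous_on (cball 0 1) g"
    unfolding g_def using poly
    by (intro continuous_intros continuous_on_polymonial_function) (simp add: real_polynomial_function_eq)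
  then obtain y where y: "y \<in> cball 0 1" "\<And>x. x \<in> cball 0 1 \<Longrightarrow> g y \<le> g x"
    using continuous_attains_inf[OF compact_cball] by (metis cball_eq_empty not_one_less_zero)
  have "g y \<le> g x0" using y(2) assms(2) by simp
  also have "g x0 \<le> 0" using assms(3) by (simp add: g_def)
  finally have "g y \<le> 0" .
  have "norm y \<noteq> 1"
  proof
    assume "norm y = 1"
    then have "g y > 0" using big[of y] by (simp add: g_def norm_eq_1)
    with \<open>g y \<le> 0\<close> show False by simp
  qed
  then have d: "1 - norm y > 0" using y(1) by simp
  have "partial_deriv i (partial_deriv i p) y \<ge> 1 / 2" for i
  proof -
    obtain q' where q': "\<And>t. ((\<lambda>t. p (y + t *\<^sub>R axis i 1)) has_real_derivative q' t) (at t)"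
      "(q' has_real_derivative partial_deriv i (partial_deriv i p) y) (at 0)"
      using partial_deriv_polynomial_line[OF poly, of y i] by blast
    have sq: "(y + t *\<^sub>R axis i 1) \<bullet> (y + t *\<^sub>R axis i 1) = y \<bullet> y + 2 * t * y $ i + t\<^sup>2" for t
      by (simp add: inner_add_left inner_add_right inner_axis inner_axis' power2_eq_square algebra_simps)
    have "partial_deriv i (partial_deriv i p) y - 1 / 2 \<ge> 0"
    proof (rule DERIV_second_nonneg_local_min)
      show "((\<lambda>t. g (y + t *\<^sub>R axis i 1)) has_real_derivative q' t - (1 / 4) * (2 * y $ i + 2 * t)) (at t)" for t
        unfolding g_def sq by (rule derivative_eq_intros q'(1) refl | simp)+
      show "((\<lambda>t. q' t - (1 / 4) * (2 * y $ i + 2 * t)) has_real_derivative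
          partial_deriv i (partial_deriv i p) y - 1 / 2) (at 0)"
        by (rule derivative_eq_intros q'(2) refl | simp)+
      show "1 - norm y > 0" by (rule d)
      fix t :: real assume t: "\<bar>t\<bar> < 1 - norm y"
      have "norm (y + t *\<^sub>R axis i 1) \<le> norm y + \<bar>t\<bar>"
        using norm_triangle_ineq[of y "t *\<^sub>R axis i 1"] by simp
      then show "g (y + 0 *\<^sub>R axis i 1) \<le> g (y + t *\<^sub>R axis i 1)"
        using y(2)[of "y + t *\<^sub>R axis i 1"] t by simp
    qed
    then show ?thesis by simp
  qed
  then have "(\<Sum>i\<in>(UNIV::'n set). 1 / 2) \<le> laplacian p y"
    unfolding laplacian_def by (intro sum_mono)
  then show False using harm[of y] by simp
qed

section \<open>The density criterion\<close>

theorem theorem2: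
  fixes x0 :: "real ^ 'n" and m :: nat
  assumes "CARD('n) \<ge> 2" and "m > 0"
  shows "dense_in (mtopology_of sphere_cfunspace)
           ((\<lambda>p. restrict p (sphere 0 1)) ` harmonic_polys_vanishing x0 m)
           (sphere_cfuns_vanishing x0)
         \<longleftrightarrow> norm x0 \<ge> 1"
proof -
  let ?S = "sphere (0 :: real ^ 'n) 1"
  let ?P = "(\<lambda>p. restrict p ?S) ` harmonic_polys_vanishing x0 m"
  let ?M = "sphere_cfunspace :: (real ^ 'n \<Rightarrow> real) metric"
  have closure: "mtopology_of ?M closure_of A =
      {f \<in> mspace ?M. \<forall>r>0. \<exists>g\<in>A. g \<in> mspace ?M \<and> mdist ?M f g < r}" for A
    unfolding mtopology_of_def Metric_space.metric_closure_of[OF Metric_space_mspace_mdist]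
    by (auto simp: Metric_space.in_mball[OF Metric_space_mspace_mdist])
  have p_cont: "continuous_on ?S p" if "p \<in> harmonic_polys_vanishing x0 m" for p
    using that by (intro continuous_on_polymonial_function)
      (simp add: harmonic_polys_vanishing_def harmonic_polynomial_def real_polynomial_function_eq)
  have p_zero: "p x0 = 0" if "p \<in> harmonic_polys_vanishing x0 m" for p
  proof -
    have "iterated_partial [] p x0 = 0" using that by (auto simp: harmonic_polys_vanishing_def dest!: spec[of _ "[]"])
    then show ?thesis by (simp add: iterated_partial_def)
  qed
  show ?thesis
  proof
    assume "norm x0 \<ge> 1"
    have "?P \<subseteq> sphere_cfuns_vanishing x0"
      using p_cont p_zero
      by (auto simp: sphere_cfuns_vanishing_def restrict_in_sphere_cfunspace_iff)
    moreover have "f \<in> mtopology_of ?M closure_of ?P" if f: "f \<in> sphere_cfuns_vanishing x0" for f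
      unfolding closure
    proof (intro CollectI conjI allI impI)
      show fM: "f \<in> mspace ?M" using f by (simp add: sphere_cfuns_vanishing_def)
      have "f \<in> extensional ?S" using fM by (simp add: sphere_cfunspace_def)
      then have "restrict f ?S = f" by (rule extensional_restrict)
      then have f_cont: "continuous_on ?S f" using fM restrict_in_sphere_cfunspace_iff[of f] by simp
      fix r :: real assume "r > 0"
      then obtain p where p: "p \<in> harmonic_polys_vanishing x0 m" "\<And>x. x \<in> ?S \<Longrightarrow> \<bar>f x - p x\<bar> < r / 2"
        using harmonic_polys_vanishing_approx[OF assms(1) \<open>norm x0 \<ge> 1\<close> f_cont, of "r / 2" m] f
        by (auto simp: sphere_cfuns_vanishing_def)
      \<comment> \<open>Half the radius is used because pointwise bounds give only a non-strict
        bound on the sup distance.\<close>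
      have "mdist ?M f (restrict p ?S) \<le> r / 2"
        unfolding sphere_cfunspace_def
        by (rule mdist_cfunspace_le) (use p(2) \<open>r > 0\<close> in \<open>auto simp: dist_real_def less_imp_le\<close>)
      then show "\<exists>g\<in>?P. g \<in> mspace ?M \<and> mdist ?M f g < r"
        using p(1) p_cont[OF p(1)] \<open>r > 0\<close>
        by (intro bexI[of _ "restrict p ?S"]) (auto simp: restrict_in_sphere_cfunspace_iff)
    qed
    ultimately show "dense_in (mtopology_of ?M) ?P (sphere_cfuns_vanishing x0)"
      unfolding dense_in_def by blast
  next
    assume dense: "dense_in (mtopology_of ?M) ?P (sphere_cfuns_vanishing x0)"
    show "norm x0 \<ge> 1"
    proof (rule ccontr)
      assume "\<not> norm x0 \<ge> 1"
      then have x0: "norm x0 < 1" by simp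
      \<comment> \<open>As x0 is off the sphere, the constant 1 belongs to the target space. An
        approximation within 1/4 would be at least 3/4 on the sphere, against the minimum
        principle.\<close>
      let ?u = "restrict (\<lambda>x. 1) ?S :: real ^ 'n \<Rightarrow> real"
      have uM: "?u \<in> mspace ?M" by (simp only: restrict_in_sphere_cfunspace_iff continuous_on_const)
      then have "?u \<in> sphere_cfuns_vanishing x0"
        using x0 by (simp add: sphere_cfuns_vanishing_def)
      then have "?u \<in> mtopology_of ?M closure_of ?P" using dense unfolding dense_in_def by blast
      then have "\<exists>g\<in>?P. g \<in> mspace ?M \<and> mdist ?M ?u g < 1 / 4"
        unfolding closure by (auto dest!: spec[of _ "1 / 4"])
      then obtain p where p: "p \<in> harmonic_polys_vanishing x0 m" "restrict p ?S \<in> mspace ?M"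
        "mdist ?M ?u (restrict p ?S) < 1 / 4" by blast
      have "harmonic_polynomial p" using p(1) by (simp add: harmonic_polys_vanishing_def)
      from harmonic_polynomial_minimum_principle[OF this x0 p_zero[OF p(1)]]
      obtain x where x: "x \<in> ?S" "p x \<le> 1 / 2" by blast
      have "mdist euclidean_metric (?u x) (restrict p ?S x) \<le> 1 / 4"
        using mdist_cfunspace_imp_mdist_le[of ?u "top_of_set ?S" euclidean_metric "restrict p ?S" "1 / 4" x]
          uM p(2,3) x(1) unfolding sphere_cfunspace_def by simp
      then show False using x by (simp add: dist_real_def)
    qed
  qed
qed

end
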